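(* Let $f\colon X\to Y$ be a non-degenerate PL map between compact polyhedra. The following are equivalent: (1) $f$ is a PL $1$-prem; (2) there exist an equivariant map $\phi\colon\Delta_f\to S^0=\{1,-1\}$ and for each $y\in Y$ a total ordering of $f^{-1}(y)$ such that for all distinct $x,x'\in f^{-1}(y)$ one has $x<x'$ if and only if $\phi(x,x')=1$; (3) there exists an equivariant map $\phi\colon\Delta_f\to S^0$ such that $\phi^3\colon(\Delta_f)^3\to(S^0)^3$ sends every triple of the form $\big((x,y),(y,z),(z,x)\big)$, $(x,y,z)\in\Delta^{(3)}_f$, into the complement of $\Delta^{(3)}_{S^0}$; (4) $f$ has no Penrose staircases, where a Penrose staircase for $f$ is a finite subset $F\subset\Delta^{(3)}_f$ such that for every equivariant map $\phi\colon\Delta_f\to S^0$ there exists an $(x,y,z)\in F$ such that $\phi(x,y)=\phi(y,z)=\phi(z,x)$; (5) there exist an $S_2$-equivariant map $\Phi\colon\Delta_f\to\tilde{\mathbb{R}}$ and an $S_3$-equivariant map $\Psi\colon\Delta^{(3)}_f\to\mathbb{R}^{(3)}$ such that for every injection $j\colon\{1,2\}\to\{1,2,3\}$ one has $\Phi\circ\pi_j=\Pi_j\circ\Psi$, where $\pi_j\colon\Delta^{(3)}_f\to\Delta_f$ and $\Pi_j\colon\mathbb{R}^{(3)}\to\tilde{\mathbb{R}}$ are the corresponding projections $(x_1,x_2,x_3)\mapsto(x_{j(1)},x_{j(2)})$.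
   Context: "Map" between spaces means continuous map. A PL map is non-degenerate if it has no point-inverses of dimension $>0$. $f\colon X\to Y$ is a PL $1$-prem if there exists a map $g\colon X\to\mathbb{R}$ such that $f\times g\colon X\to Y\times\mathbb{R}$, $x\mapsto(f(x),g(x))$, is a PL embedding. For a space $X$: $\tilde X=\{(x,y)\in X^2\mid x\ne y\}$, $\Delta^{(3)}_X=\{(x,x,x)\in X^3\}$, $X^{(3)}=\{(x,y,z)\in X^3\mid x\ne y\ne z\ne x\}$. For a map $f\colon X\to Y$: $\Delta_f=\{(x,y)\in\tilde X\mid f(x)=f(y)\}$ and $\Delta^{(3)}_f=\{(x,y,z)\in X^{(3)}\mid f(x)=f(y)=f(z)\}$. The symmetric group $S_i$ acts on these sets by permuting the factors ($i=2$ for $\tilde X,\Delta_f$; $i=3$ for $X^{(3)},\Delta^{(3)}_f$). $S^0=\{1,-1\}$ carries the antipodal involution; "equivariant map $\Delta_f\to S^0$" means equivariant with respect to $(x,y)\mapsto(y,x)$ and the antipodal involution. *)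

theory Defs
  imports "HOL-Analysis.Analysis"
begin

definition compact_polyhedron :: "'a::euclidean_space set \<Rightarrow> bool" where
  "compact_polyhedron X \<longleftrightarrow> (\<exists>K. simplicial_complex K \<and> \<Union>K = X)"

definition affine_map_on :: "'a::real_vector set \<Rightarrow> ('a \<Rightarrow> 'b::real_vector) \<Rightarrow> bool" where
  "affine_map_on S f \<longleftrightarrow> (\<exists>A b. linear A \<and> (\<forall>x\<in>S. f x = A x + b))"

(* The domain X is a compact polyhedron (it is triangulated by K); the codomain need not
   be compact. Continuity on X is automatic, since K is a finite closed cover of X. *)
definition pl_map :: "'a::euclidean_space set \<Rightarrow> 'b::euclidean_space set \<Rightarrow> ('a \<Rightarrow> 'b) \<Rightarrow> bool" where
  "pl_map X Y f \<longleftrightarrow> f \<in> X \<rightarrow> Y \<and>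
     (\<exists>K. simplicial_complex K \<and> \<Union>K = X \<and> (\<forall>S\<in>K. affine_map_on S f))"

definition pl_embedding :: "'a::euclidean_space set \<Rightarrow> 'b::euclidean_space set \<Rightarrow> ('a \<Rightarrow> 'b) \<Rightarrow> bool" where
  "pl_embedding X Y f \<longleftrightarrow> pl_map X Y f \<and> (\<exists>g. homeomorphism X (f ` X) f g)"

definition fibre :: "'a set \<Rightarrow> ('a \<Rightarrow> 'b) \<Rightarrow> 'b \<Rightarrow> 'a set" where
  "fibre X f y = {x\<in>X. f x = y}"

(* The largest dimension of a simplex contained in P; this differs from aff_dim P, which is
   the dimension of the affine hull. The value is -1 for the empty set, and the supremum is
   attained because the dimensions are bounded by that of the ambient space. *)
definition poly_dim :: "'a::euclidean_space set \<Rightarrow> int" where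
  "poly_dim P = Sup {n. \<exists>S. n simplex S \<and> S \<subseteq> P}"

definition non_degenerate :: "'a::euclidean_space set \<Rightarrow> 'b::euclidean_space set \<Rightarrow> ('a \<Rightarrow> 'b) \<Rightarrow> bool" where
  "non_degenerate X Y f \<longleftrightarrow> (\<forall>y\<in>Y. \<not> poly_dim (fibre X f y) > 0)"

definition pl_1_prem :: "'a::euclidean_space set \<Rightarrow> 'b::euclidean_space set \<Rightarrow> ('a \<Rightarrow> 'b) \<Rightarrow> bool" where
  "pl_1_prem X Y f \<longleftrightarrow>
     (\<exists>g::'a \<Rightarrow> real. continuous_on X g \<and> pl_embedding X (Y \<times> UNIV) (\<lambda>x. (f x, g x)))"

definition deleted_square :: "'a set \<Rightarrow> ('a \<times> 'a) set" where
  "deleted_square X = {(x, y). x \<in> X \<and> y \<in> X \<and> x \<noteq> y}"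

definition deleted_cube :: "'a set \<Rightarrow> ('a \<times> 'a \<times> 'a) set" where
  "deleted_cube X = {(x, y, z). x \<in> X \<and> y \<in> X \<and> z \<in> X \<and> x \<noteq> y \<and> y \<noteq> z \<and> z \<noteq> x}"

definition thin_diagonal :: "'a set \<Rightarrow> ('a \<times> 'a \<times> 'a) set" where
  "thin_diagonal X = {(x, x, x) | x. x \<in> X}"

definition double_points :: "'a set \<Rightarrow> ('a \<Rightarrow> 'b) \<Rightarrow> ('a \<times> 'a) set" where
  "double_points X f = {(x, y). (x, y) \<in> deleted_square X \<and> f x = f y}"

definition triple_points :: "'a set \<Rightarrow> ('a \<Rightarrow> 'b) \<Rightarrow> ('a \<times> 'a \<times> 'a) set" where
  "triple_points X f = {(x, y, z). (x, y, z) \<in> deleted_cube X \<and> f x = f y \<and> f y = f z}"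

definition sphere0 :: "real set" where
  "sphere0 = {1, -1}"

definition equivariant_sign ::
  "'a::topological_space set \<Rightarrow> ('a \<Rightarrow> 'b) \<Rightarrow> ('a \<times> 'a \<Rightarrow> real) \<Rightarrow> bool" where
  "equivariant_sign X f \<phi> \<longleftrightarrow>
     continuous_on (double_points X f) \<phi> \<and> \<phi> \<in> double_points X f \<rightarrow> sphere0 \<and>
     (\<forall>p\<in>double_points X f. \<phi> (prod.swap p) = - \<phi> p)"

definition penrose_staircase ::
  "'a::topological_space set \<Rightarrow> ('a \<Rightarrow> 'b) \<Rightarrow> ('a \<times> 'a \<times> 'a) set \<Rightarrow> bool" where
  "penrose_staircase X f F \<longleftrightarrow> finite F \<and> F \<subseteq> triple_points X f \<and>
     (\<forall>\<phi>. equivariant_sign X f \<phi> \<longrightarrow>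
        (\<exists>(x, y, z)\<in>F. \<phi> (x, y) = \<phi> (y, z) \<and> \<phi> (y, z) = \<phi> (z, x)))"

(* i-th coordinate of a triple, for i in {1,2,3} *)
fun coord3 :: "'a \<times> 'a \<times> 'a \<Rightarrow> nat \<Rightarrow> 'a" where
  "coord3 (x, y, z) i = (if i = 1 then x else if i = 2 then y else z)"

definition permute3 :: "(nat \<Rightarrow> nat) \<Rightarrow> 'a \<times> 'a \<times> 'a \<Rightarrow> 'a \<times> 'a \<times> 'a" where
  "permute3 \<sigma> t = (coord3 t (\<sigma> 1), coord3 t (\<sigma> 2), coord3 t (\<sigma> 3))"

definition proj32 :: "(nat \<Rightarrow> nat) \<Rightarrow> 'a \<times> 'a \<times> 'a \<Rightarrow> 'a \<times> 'a" where
  "proj32 j t = (coord3 t (j 1), coord3 t (j 2))"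

definition S2_map ::
  "('a::topological_space \<times> 'a) set \<Rightarrow> ('b::topological_space \<times> 'b) set \<Rightarrow> ('a \<times> 'a \<Rightarrow> 'b \<times> 'b) \<Rightarrow> bool" where
  "S2_map A B h \<longleftrightarrow> continuous_on A h \<and> h \<in> A \<rightarrow> B \<and>
     (\<forall>p\<in>A. h (prod.swap p) = prod.swap (h p))"

(* Commuting with permute3 for all permutations is the same condition for the left action
   and for the right action of the symmetric group on triples. *)
definition S3_map ::
  "('a::topological_space \<times> 'a \<times> 'a) set \<Rightarrow> ('b::topological_space \<times> 'b \<times> 'b) set \<Rightarrow>
   ('a \<times> 'a \<times> 'a \<Rightarrow> 'b \<times> 'b \<times> 'b) \<Rightarrow> bool" where
  "S3_map A B h \<longleftrightarrow> continuous_on A h \<and> h \<in> A \<rightarrow> B \<and>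
     (\<forall>\<sigma>. bij_betw \<sigma> {1, 2, 3} {1, 2, 3} \<longrightarrow>
        (\<forall>t\<in>A. h (permute3 \<sigma> t) = permute3 \<sigma> (h t)))"

end

theory Submission
  imports Defs
begin

text \<open>
  All five conditions speak of a sign \<open>\<phi>\<close> deciding which of two points of a fibre is the higher one.
  A height \<open>g\<close> that makes \<open>f \<times> g\<close> injective has \<open>g x \<noteq> g y\<close> at every double point, so the sign of
  \<open>g y - g x\<close> is a continuous equivariant sign, the order of the values of \<open>g\<close> orders the fibres, and
  \<open>g \<times> g\<close> and \<open>g \<times> g \<times> g\<close> are the two equivariant maps of the last condition. Conversely, fibre
  orders and such pairs of maps yield a sign that is constant on no 3-cycle, called acyclic here.
  An acyclic sign is transitive, as a tournament without 3-cycles is. What remains is that an acyclic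
  sign yields a PL embedding, and that it exists if there is no Penrose staircase.

  Both rest on the following. Since \<open>f\<close> is non-degenerate, it is injective on every simplex of a
  triangulation on which it is simplexwise affine. For two simplices \<open>S\<close> and \<open>T\<close>, the
  pairs \<open>(x, y) \<in> S \<times> T\<close> with \<open>x \<noteq> y\<close> and \<open>f x = f y\<close> form a convex set: if a proper convex combination
  of two such pairs lay on the diagonal, all four points would lie in the common face \<open>S \<inter> T\<close>, on
  which \<open>f\<close> is injective (\<open>convex_double_point_cell\<close>). So the space of double points is a finite
  union of convex cells, and every equivariant sign is constant on each of them.

  Hence there are finitely many signs (\<open>finite_equivariant_signs\<close>); if none is acyclic, choosing
  one bad triple for each sign gives a finite set, which is a Penrose staircase.

  To build a height from an acyclic sign, the triangulation is subdivided so that \<open>f\<close> becomes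
  simplicial (\<open>simplicial_subdivision_of_map\<close>). A vertex \<open>v\<close> gets as height the number of vertices
  of its fibre that the sign puts below \<open>v\<close>, and the height is extended affinely over the simplices.
  For a double point \<open>(x, y)\<close> the points \<open>x\<close> and \<open>y\<close> have the same barycentric coordinates
  with respect to corresponding vertices of two simplices. Two distinct corresponding vertices form
  a double point in the same convex cell as \<open>(x, y)\<close>, so all these pairs are ordered
  in the same way as \<open>(x, y)\<close>, and averaging keeps the strict inequality
  (\<open>height_from_transitive_sign\<close>).
\<close>

section \<open>Affine maps that are injective on a convex set\<close>

lemma affine_map_on_subset: "affine_map_on S f \<Longrightarrow> T \<subseteq> S \<Longrightarrow> affine_map_on T f"
  unfolding affine_map_on_def by blast

lemma affine_map_on_sum:
  assumes "affine_map_on S f" "\<And>i. i \<in> I \<Longrightarrow> p i \<in> S" "sum u I = 1" "(\<Sum>i\<in>I. u i *\<^sub>R p i) \<in> S"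
  shows "f (\<Sum>i\<in>I. u i *\<^sub>R p i) = (\<Sum>i\<in>I. u i *\<^sub>R f (p i))"
proof -
  obtain A b where "linear A" and f: "\<And>x. x \<in> S \<Longrightarrow> f x = A x + b"
    using assms(1) unfolding affine_map_on_def by blast
  have "f (\<Sum>i\<in>I. u i *\<^sub>R p i) = (\<Sum>i\<in>I. u i *\<^sub>R A (p i)) + sum u I *\<^sub>R b"
    using assms f \<open>linear A\<close> by (simp add: linear_sum linear_cmul)
  also have "\<dots> = (\<Sum>i\<in>I. u i *\<^sub>R (A (p i) + b))"
    by (simp add: scaleR_sum_left scaleR_add_right sum.distrib)
  also have "\<dots> = (\<Sum>i\<in>I. u i *\<^sub>R f (p i))"
    using f assms(2) by simp
  finally show ?thesis .
qed

lemma affine_map_on_segment: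
  assumes "affine_map_on S f" "x \<in> S" "y \<in> S" "(1 - u) *\<^sub>R x + u *\<^sub>R y \<in> S"
  shows "f ((1 - u) *\<^sub>R x + u *\<^sub>R y) = (1 - u) *\<^sub>R f x + u *\<^sub>R f y"
proof -
  obtain A b where "linear A" and f: "\<And>x. x \<in> S \<Longrightarrow> f x = A x + b"
    using assms(1) unfolding affine_map_on_def by blast
  show ?thesis
    using f assms(2-4) \<open>linear A\<close> by (simp add: linear_add linear_diff linear_cmul algebra_simps)
qed

lemma affine_map_on_imp_continuous_on:
  fixes f :: "'a::euclidean_space \<Rightarrow> 'b::euclidean_space"
  assumes "affine_map_on S f"
  shows "continuous_on S f"
proof -
  obtain A b where "linear A" and f: "\<And>x. x \<in> S \<Longrightarrow> f x = A x + b"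
    using assms unfolding affine_map_on_def by blast
  have "continuous_on S (\<lambda>x. A x + b)"
    using \<open>linear A\<close> by (intro continuous_intros linear_continuous_on) (simp add: linear_conv_bounded_linear)
  then show ?thesis using f by (simp cong: continuous_on_cong)
qed

lemma affine_map_on_Pair:
  assumes "affine_map_on S f" "affine_map_on S g"
  shows "affine_map_on S (\<lambda>x. (f x, g x))"
proof -
  obtain A b where A: "linear A" "\<And>x. x \<in> S \<Longrightarrow> f x = A x + b"
    using assms unfolding affine_map_on_def by blast
  obtain B c where B: "linear B" "\<And>x. x \<in> S \<Longrightarrow> g x = B x + c"
    using assms unfolding affine_map_on_def by blast
  have "linear (\<lambda>x. (A x, B x))"
    using A(1) B(1) by (intro linearI) (auto simp: linear_add linear_cmul)
  moreover have "\<forall>x\<in>S. (f x, g x) = (A x, B x) + (b, c)"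
    using A B by simp
  ultimately show ?thesis unfolding affine_map_on_def by blast
qed

lemma convex_affine_image:
  assumes "affine_map_on S f" "convex S"
  shows "convex (f ` S)"
  unfolding convex_alt
proof clarify
  fix x y and u :: real
  assume xy: "x \<in> S" "y \<in> S" and u: "0 \<le> u" "u \<le> 1"
  have m: "(1 - u) *\<^sub>R x + u *\<^sub>R y \<in> S" using \<open>convex S\<close> xy u unfolding convex_alt by blast
  have "(1 - u) *\<^sub>R f x + u *\<^sub>R f y = f ((1 - u) *\<^sub>R x + u *\<^sub>R y)"
    using affine_map_on_segment[OF assms(1) xy m] by simp
  then show "(1 - u) *\<^sub>R f x + u *\<^sub>R f y \<in> f ` S" using m by blast
qed

lemma convex_affine_preimage:
  assumes "affine_map_on S f" "convex S" "convex \<sigma>"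
  shows "convex (S \<inter> f -` \<sigma>)"
  unfolding convex_alt
proof clarify
  fix x y and u :: real
  assume xy: "x \<in> S" "y \<in> S" "f x \<in> \<sigma>" "f y \<in> \<sigma>" and u: "0 \<le> u" "u \<le> 1"
  have m: "(1 - u) *\<^sub>R x + u *\<^sub>R y \<in> S" using \<open>convex S\<close> xy u unfolding convex_alt by blast
  moreover have "(1 - u) *\<^sub>R f x + u *\<^sub>R f y \<in> \<sigma>" using \<open>convex \<sigma>\<close> xy u unfolding convex_alt by blast
  ultimately show "(1 - u) *\<^sub>R x + u *\<^sub>R y \<in> S \<inter> f -` \<sigma>"
    using affine_map_on_segment[OF assms(1) xy(1,2) m] by simp
qed

text \<open>
  Faces are defined through open segments, so this is why faces are carried back and forth
  by a map that is affine and injective on \<open>S\<close>.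
\<close>

lemma open_segment_affine_iff:
  assumes "affine_map_on S f" "convex S" "inj_on f S" "a \<in> S" "b \<in> S" "x \<in> S"
  shows "f x \<in> open_segment (f a) (f b) \<longleftrightarrow> x \<in> open_segment a b"
proof -
  have mem: "(1 - u) *\<^sub>R a + u *\<^sub>R b \<in> S" if "0 < u" "u < 1" for u
    using assms that unfolding convex_alt by (meson less_imp_le)
  have "f x = (1 - u) *\<^sub>R f a + u *\<^sub>R f b \<longleftrightarrow> x = (1 - u) *\<^sub>R a + u *\<^sub>R b" if "0 < u" "u < 1" for u
    using affine_map_on_segment[OF assms(1,4,5) mem[OF that]] inj_onD[OF assms(3) _ assms(6) mem[OF that]]
    by auto
  moreover have "f a = f b \<longleftrightarrow> a = b" using assms by (auto dest: inj_onD)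
  ultimately show ?thesis unfolding in_segment by blast
qed

lemma face_of_affine_preimage:
  assumes f: "affine_map_on S f" "convex S" "inj_on f S" and "\<rho> face_of \<sigma>"
  shows "(S \<inter> f -` \<rho>) face_of (S \<inter> f -` \<sigma>)"
  unfolding face_of_def
proof (intro conjI ballI impI)
  show "S \<inter> f -` \<rho> \<subseteq> S \<inter> f -` \<sigma>" using face_of_imp_subset[OF assms(4)] by blast
  show "convex (S \<inter> f -` \<rho>)"
    using convex_affine_preimage[OF f(1,2)] face_of_imp_convex[OF assms(4)] by blast
  fix a b x
  assume ab: "a \<in> S \<inter> f -` \<sigma>" "b \<in> S \<inter> f -` \<sigma>" "x \<in> S \<inter> f -` \<rho>" "x \<in> open_segment a b"
  then have "f x \<in> open_segment (f a) (f b)" using open_segment_affine_iff[OF f, of a b x] by blast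
  then have "f a \<in> \<rho> \<and> f b \<in> \<rho>" using ab assms(4) unfolding face_of_def by blast
  then show "a \<in> S \<inter> f -` \<rho>" "b \<in> S \<inter> f -` \<rho>" using ab by auto
qed

lemma face_of_affine_image:
  assumes f: "affine_map_on S f" "convex S" "inj_on f S" and "\<sigma> \<subseteq> f ` S"
    and F: "F face_of (S \<inter> f -` \<sigma>)"
  shows "f ` F face_of \<sigma>"
  unfolding face_of_def
proof (intro conjI ballI impI)
  have FS: "F \<subseteq> S \<inter> f -` \<sigma>" using face_of_imp_subset[OF F] .
  then show "f ` F \<subseteq> \<sigma>" by blast
  show "convex (f ` F)"
    using affine_map_on_subset[OF f(1), of F] FS face_of_imp_convex[OF F]
    by (intro convex_affine_image) auto
  fix p q z
  assume pq: "p \<in> \<sigma>" "q \<in> \<sigma>" "z \<in> f ` F" "z \<in> open_segment p q"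
  then obtain a b x where ab: "a \<in> S" "b \<in> S" "x \<in> F" "p = f a" "q = f b" "z = f x"
    using \<open>\<sigma> \<subseteq> f ` S\<close> by blast
  then have "x \<in> open_segment a b"
    using open_segment_affine_iff[OF f, of a b x] pq FS by blast
  then have "a \<in> F \<and> b \<in> F" using F ab pq unfolding face_of_def by blast
  then show "p \<in> f ` F" "q \<in> f ` F" using ab by auto
qed

text \<open>
  The inverse of an injective affine map is affine on the image; it is stated for convex combinations
  because this is how it transports barycentric coordinates from a simplex of the target.
\<close>

lemma affine_section_combination:
  assumes f: "affine_map_on S f" "convex S" "inj_on f S"
    and C: "finite C" "C \<subseteq> f ` S"
    and u: "\<And>c. c \<in> C \<Longrightarrow> 0 \<le> u c" "sum u C = 1"
    and x: "x \<in> S" "f x = (\<Sum>c\<in>C. u c *\<^sub>R c)"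
  shows "x = (\<Sum>c\<in>C. u c *\<^sub>R inv_into S f c)"
proof -
  have s: "inv_into S f c \<in> S" "f (inv_into S f c) = c" if "c \<in> C" for c
    using C(2) that by (auto simp: inv_into_into f_inv_into_f)
  let ?y = "\<Sum>c\<in>C. u c *\<^sub>R inv_into S f c"
  have y: "?y \<in> S" using C(1) u s f(2) by (intro convex_sum) auto
  have "f ?y = (\<Sum>c\<in>C. u c *\<^sub>R f (inv_into S f c))"
    using affine_map_on_sum[OF f(1) _ u(2) y] s by blast
  then have "f ?y = f x" using x(2) s by simp
  then show ?thesis using inj_onD[OF f(3) _ y x(1)] by simp
qed

lemma simplex_affine_preimage:
  assumes f: "affine_map_on S f" "convex S" "inj_on f S" and "\<sigma> \<subseteq> f ` S" and "n simplex \<sigma>"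
  shows "n simplex (S \<inter> f -` \<sigma>)"
proof -
  obtain C where C: "finite C" "\<not> affine_dependent C" "int (card C) = n + 1" "\<sigma> = convex hull C"
    using \<open>n simplex \<sigma>\<close> unfolding simplex by blast
  have C\<sigma>: "C \<subseteq> \<sigma>" using C(4) hull_subset[of C convex] by simp
  define V where "V = S \<inter> f -` C"
  have bij: "bij_betw f V C"
    unfolding bij_betw_def
  proof
    show "inj_on f V" using f(3) V_def by (simp add: inj_on_subset)
    show "f ` V = C" using assms(4) C\<sigma> V_def by blast
  qed
  have V: "finite V" using bij C(1) bij_betw_finite by blast
  have "\<not> affine_dependent V"
  proof
    assume "affine_dependent V"
    then obtain U v where U: "sum U V = 0" "v \<in> V" "U v \<noteq> 0" "(\<Sum>v\<in>V. U v *\<^sub>R v) = 0"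
      using affine_dependent_explicit_finite[OF V] by blast
    obtain A b where "linear A" and fA: "\<And>x. x \<in> S \<Longrightarrow> f x = A x + b"
      using f(1) unfolding affine_map_on_def by blast
    have "(\<Sum>v\<in>V. U v *\<^sub>R f v) = (\<Sum>v\<in>V. U v *\<^sub>R A v) + sum U V *\<^sub>R b"
      using fA unfolding V_def by (simp add: scaleR_sum_left scaleR_add_right sum.distrib)
    also have "\<dots> = A (\<Sum>v\<in>V. U v *\<^sub>R v)"
      using U(1) \<open>linear A\<close> by (simp add: linear_sum linear_cmul)
    also have "\<dots> = 0" using U \<open>linear A\<close> by (simp add: linear_0)
    finally have 0: "(\<Sum>v\<in>V. U v *\<^sub>R f v) = 0" .
    define W where "W = (\<lambda>c. U (the_inv_into V f c))"
    have Wf: "W (f v) = U v" if "v \<in> V" for v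
      unfolding W_def using bij that by (simp add: the_inv_into_f_f bij_betw_def)
    have "sum W C = 0"
      using sum.reindex_bij_betw[OF bij, of W] U Wf by simp
    moreover have "(\<Sum>c\<in>C. W c *\<^sub>R c) = 0"
      using sum.reindex_bij_betw[OF bij, of "\<lambda>c. W c *\<^sub>R c"] 0 Wf by simp
    moreover have "f v \<in> C" "W (f v) \<noteq> 0" using U Wf V_def by auto
    ultimately have "affine_dependent C"
      using affine_dependent_explicit_finite[OF C(1)] by blast
    then show False using C(2) by blast
  qed
  moreover have "int (card V) = n + 1" using C(3) bij_betw_same_card[OF bij] by simp
  moreover have "S \<inter> f -` \<sigma> = convex hull V"
  proof
    show "convex hull V \<subseteq> S \<inter> f -` \<sigma>"
    proof (rule hull_minimal)
      show "V \<subseteq> S \<inter> f -` \<sigma>" using V_def C\<sigma> by blast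
      show "convex (S \<inter> f -` \<sigma>)"
        using convex_affine_preimage[OF f(1,2)] C(4) by simp
    qed
    show "S \<inter> f -` \<sigma> \<subseteq> convex hull V"
    proof
      fix x assume x: "x \<in> S \<inter> f -` \<sigma>"
      then obtain u where u: "\<forall>c\<in>C. 0 \<le> u c" "sum u C = 1" "(\<Sum>c\<in>C. u c *\<^sub>R c) = f x"
        using C(1,4) convex_hull_finite[of C] by auto
      have "x = (\<Sum>c\<in>C. u c *\<^sub>R inv_into S f c)"
        using u x C(1) C\<sigma> assms(4) by (intro affine_section_combination[OF f]) auto
      moreover have "inv_into S f c \<in> convex hull V" if "c \<in> C" for c
      proof (rule hull_inc)
        have "c \<in> f ` S" using that C\<sigma> assms(4) by blast
        then show "inv_into S f c \<in> V"
          using that V_def by (simp add: inv_into_into f_inv_into_f)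
      qed
      ultimately show "x \<in> convex hull V"
        using u C(1) by (auto intro!: convex_sum)
    qed
  qed
  ultimately show ?thesis unfolding simplex using V by blast
qed

section \<open>Making a piecewise affine map simplicial\<close>

text \<open>
  The hyperplanes bounding the given polytopes cut a large box into cells, none of which crosses
  one of these hyperplanes. A simplicial subdivision of the cells inherits this property, and then every
  polytope is a union of simplices, namely of those faces that lie on the right side of
  all of its hyperplanes.
\<close>

lemma simplicial_complex_refining_polytopes:
  fixes P :: "'a::euclidean_space set set"
  assumes "finite P" and P: "\<And>p. p \<in> P \<Longrightarrow> polytope p"
  obtains L where "simplicial_complex L"
    "\<And>p x. p \<in> P \<Longrightarrow> x \<in> p \<Longrightarrow> \<exists>\<sigma>\<in>L. x \<in> \<sigma> \<and> \<sigma> \<subseteq> p"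
proof -
  have "\<exists>H. finite H \<and> p = {x. \<forall>(a, b)\<in>H. a \<bullet> x \<le> b}" if p: "p \<in> P" for p
  proof -
    obtain F where F: "finite F" "p = \<Inter>F" "\<forall>h\<in>F. \<exists>a b. a \<noteq> 0 \<and> h = {x. a \<bullet> x \<le> b}"
      using polytope_imp_polyhedron[OF P[OF p]] unfolding polyhedron_def by blast
    then obtain a b where ab: "\<And>h. h \<in> F \<Longrightarrow> h = {x. a h \<bullet> x \<le> b h}" by metis
    have "p = {x. \<forall>(c, d)\<in>(\<lambda>h. (a h, b h)) ` F. c \<bullet> x \<le> d}"
      using ab F(2) by auto
    then show ?thesis using F(1) by blast
  qed
  then have "\<forall>p\<in>P. \<exists>H. finite H \<and> p = {x. \<forall>(a, b)\<in>H. a \<bullet> x \<le> b}" by (intro ballI)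
  from bchoice[OF this] obtain H
    where H': "\<forall>p\<in>P. finite (H p) \<and> p = {x. \<forall>(a, b)\<in>H p. a \<bullet> x \<le> b}" ..
  have finH: "finite (H p)" if "p \<in> P" for p
    using H'[rule_format, OF that] by (rule conjunct1)
  have H: "x \<in> p \<longleftrightarrow> (\<forall>(a, b)\<in>H p. a \<bullet> x \<le> b)" if "p \<in> P" for p x
    using H'[rule_format, OF that, THEN conjunct2] by (simp add: set_eq_iff)
  have "bounded (\<Union>P)"
    using assms polytope_imp_bounded by (intro bounded_Union) auto
  then obtain c where c: "\<Union>P \<subseteq> cbox (- c) c" using bounded_subset_cbox_symmetric by blast
  let ?B = "cbox (- c) c" and ?I = "\<Union>(H ` P)"
  have "\<exists>\<G>. \<Union>\<G> = \<Union>{?B} \<and> finite \<G> \<and> (\<forall>C\<in>\<G>. \<exists>D. D \<in> {?B} \<and> C \<subseteq> D) \<and>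
      (\<forall>C\<in>{?B}. \<forall>x\<in>C. \<exists>D. D \<in> \<G> \<and> x \<in> D \<and> D \<subseteq> C) \<and>
      (\<forall>X\<in>\<G>. polytope X) \<and> (\<forall>X\<in>\<G>. aff_dim X \<le> DIM('a)) \<and>
      (\<forall>X\<in>\<G>. \<forall>Y\<in>\<G>. X \<inter> Y face_of X) \<and>
      (\<forall>X\<in>\<G>. \<forall>x\<in>X. \<forall>y\<in>X. \<forall>a b. (a, b) \<in> ?I \<longrightarrow>
         a \<bullet> x \<le> b \<and> a \<bullet> y \<le> b \<or> a \<bullet> x \<ge> b \<and> a \<bullet> y \<ge> b)"
    using assms(1) finH
    by (intro cell_subdivision_lemma) (auto simp: polytope_interval aff_dim_le_DIM face_of_refl)
  then obtain \<G> where \<G>: "\<Union>\<G> = ?B" "finite \<G>" "\<And>C. C \<in> \<G> \<Longrightarrow> polytope C"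
    "\<And>C D. C \<in> \<G> \<Longrightarrow> D \<in> \<G> \<Longrightarrow> C \<inter> D face_of C"
    and side: "\<And>C x y a b. C \<in> \<G> \<Longrightarrow> x \<in> C \<Longrightarrow> y \<in> C \<Longrightarrow> (a, b) \<in> ?I \<Longrightarrow>
         a \<bullet> x \<le> b \<and> a \<bullet> y \<le> b \<or> a \<bullet> x \<ge> b \<and> a \<bullet> y \<ge> b"
    by (auto 0 0)
  obtain L where L: "simplicial_complex L" "\<Union>L = \<Union>\<G>" "\<And>S. S \<in> L \<Longrightarrow> \<exists>C. C \<in> \<G> \<and> S \<subseteq> C"
    using simplicial_subdivision_of_cell_complex[OF \<G>(2,3,4)] by metis
  show thesis
  proof (rule that[OF L(1)])
    fix p x assume p: "p \<in> P" "x \<in> p"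
    then have "x \<in> \<Union>L" using c L(2) \<G>(1) by blast
    then obtain S C where S: "S \<in> L" "x \<in> S" "C \<in> \<G>" "S \<subseteq> C" using L(3) by blast
    have "convex S" using L(1) S(1) convex_simplex unfolding simplicial_complex_def by blast
    \<comment> \<open>The simplex \<open>S\<close> may lie on the wrong side of some of the hyperplanes bounding \<open>p\<close>; since \<open>x\<close>
      is in \<open>p\<close>, it then lies on these hyperplanes, and they cut out a face of \<open>S\<close>.\<close>
    define J where "J = {(a, b)\<in>H p. \<exists>y\<in>S. b < a \<bullet> y}"
    have ge: "b \<le> a \<bullet> z" if ab: "(a, b) \<in> J" "z \<in> S" for a b z
    proof -
      obtain y where y: "y \<in> S" "b < a \<bullet> y" using ab unfolding J_def by blast
      moreover have "(a, b) \<in> ?I" using ab p unfolding J_def by blast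
      ultimately show ?thesis using side[OF S(3), of y z a b] ab S(4) by auto
    qed
    define \<sigma> where "\<sigma> = \<Inter>(insert S ((\<lambda>(a, b). S \<inter> {z. a \<bullet> z = b}) ` J))"
    have "\<sigma> face_of S"
      unfolding \<sigma>_def
    proof (rule face_of_Inter)
      fix T assume "T \<in> insert S ((\<lambda>(a, b). S \<inter> {z. a \<bullet> z = b}) ` J)"
      then show "T face_of S"
        using \<open>convex S\<close> ge by (auto intro!: face_of_refl face_of_Int_supporting_hyperplane_ge)
    qed simp
    then have "\<sigma> \<in> L" using L(1) S(1) unfolding simplicial_complex_def by blast
    moreover have "a \<bullet> x = b" if "(a, b) \<in> J" for a b
    proof -
      have "a \<bullet> x \<le> b" using that H[OF p(1)] p(2) unfolding J_def by fastforce
      then show ?thesis using ge[OF that S(2)] by linarith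
    qed
    then have "x \<in> \<sigma>" unfolding \<sigma>_def using S by auto
    moreover have "\<sigma> \<subseteq> p"
    proof
      fix z assume z: "z \<in> \<sigma>"
      have "a \<bullet> z \<le> b" if ab: "(a, b) \<in> H p" for a b
      proof (cases "(a, b) \<in> J")
        case True
        then show ?thesis using z unfolding \<sigma>_def by auto
      next
        case False
        then show ?thesis using z ab unfolding \<sigma>_def J_def by auto
      qed
      then show "z \<in> p" using H[OF p(1)] by blast
    qed
    ultimately show "\<exists>\<sigma>\<in>L. x \<in> \<sigma> \<and> \<sigma> \<subseteq> p" by blast
  qed
qed

text \<open>
  The condition \<open>\<sigma> \<subseteq> f ` S\<close> keeps only those simplices of \<open>L\<close> that have a full copy in \<open>S\<close>, so that
  each member is mapped onto a simplex of \<open>L\<close>.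
\<close>

definition pullback_complex ::
  "('a \<Rightarrow> 'b) \<Rightarrow> 'a set set \<Rightarrow> 'b set set \<Rightarrow> 'a set set" where
  "pullback_complex f K L = {S \<inter> f -` \<sigma> |S \<sigma>. S \<in> K \<and> \<sigma> \<in> L \<and> \<sigma> \<subseteq> f ` S}"

lemma simplicial_complexD:
  assumes K: "simplicial_complex K"
  shows "finite K" "\<And>S. S \<in> K \<Longrightarrow> convex S" "\<And>S. S \<in> K \<Longrightarrow> compact S" "\<And>S. S \<in> K \<Longrightarrow> polytope S"
    "\<And>F S. S \<in> K \<Longrightarrow> F face_of S \<Longrightarrow> F \<in> K"
    "\<And>S T. S \<in> K \<Longrightarrow> T \<in> K \<Longrightarrow> (S \<inter> T) face_of S"
    "\<And>S T. S \<in> K \<Longrightarrow> T \<in> K \<Longrightarrow> S \<inter> T \<in> K"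
proof -
  show "finite K" and face: "\<And>F S. S \<in> K \<Longrightarrow> F face_of S \<Longrightarrow> F \<in> K"
    and inter: "\<And>S T. S \<in> K \<Longrightarrow> T \<in> K \<Longrightarrow> (S \<inter> T) face_of S"
    using K unfolding simplicial_complex_def by blast+
  show "S \<inter> T \<in> K" if "S \<in> K" "T \<in> K" for S T
    using face[OF that(1) inter[OF that]] .
  fix S assume "S \<in> K"
  then have "\<exists>n. n simplex S" using K unfolding simplicial_complex_def by blast
  then show "convex S" "compact S" "polytope S"
    using convex_simplex compact_simplex simplex_imp_polytope by blast+
qed

lemma simplicial_complex_pullback:
  assumes K: "simplicial_complex K" and L: "simplicial_complex L"
    and f: "\<And>S. S \<in> K \<Longrightarrow> affine_map_on S f" "\<And>S. S \<in> K \<Longrightarrow> inj_on f S"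
  shows "simplicial_complex (pullback_complex f K L)"
  unfolding simplicial_complex_def
proof (intro conjI ballI allI impI)
  note KD = simplicial_complexD[OF K] and LD = simplicial_complexD[OF L]
  have "pullback_complex f K L \<subseteq> (\<lambda>(S, \<sigma>). S \<inter> f -` \<sigma>) ` (K \<times> L)"
    unfolding pullback_complex_def by auto
  then show "finite (pullback_complex f K L)"
    by (rule finite_subset) (simp add: KD(1) LD(1))
  show "\<exists>n. n simplex U" if U: "U \<in> pullback_complex f K L" for U
  proof -
    obtain S \<sigma> where S: "U = S \<inter> f -` \<sigma>" "S \<in> K" "\<sigma> \<in> L" "\<sigma> \<subseteq> f ` S"
      using U unfolding pullback_complex_def by blast
    moreover obtain n where "n simplex \<sigma>" using L S(3) unfolding simplicial_complex_def by blast
    ultimately show ?thesis using simplex_affine_preimage f KD(2) by blast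
  qed
  show "F \<in> pullback_complex f K L" if U: "U \<in> pullback_complex f K L \<and> F face_of U" for U F
  proof -
    obtain S \<sigma> where S: "U = S \<inter> f -` \<sigma>" "S \<in> K" "\<sigma> \<in> L" "\<sigma> \<subseteq> f ` S"
      using U unfolding pullback_complex_def by blast
    have "f ` F face_of \<sigma>"
      using face_of_affine_image[OF f(1) KD(2) f(2)] S U by blast
    then have "f ` F \<in> L" using LD(5) S by blast
    moreover have "F \<subseteq> S" using U S face_of_imp_subset by blast
    then have "F = S \<inter> f -` (f ` F)" using f(2)[OF S(2)] by (auto dest: inj_onD)
    moreover have "f ` F \<subseteq> f ` S" using \<open>F \<subseteq> S\<close> by blast
    ultimately show ?thesis unfolding pullback_complex_def using S by blast
  qed
  show "(U \<inter> V) face_of U" if U: "U \<in> pullback_complex f K L \<and> V \<in> pullback_complex f K L" for U V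
  proof -
    obtain S \<sigma> where S: "U = S \<inter> f -` \<sigma>" "S \<in> K" "\<sigma> \<in> L" "\<sigma> \<subseteq> f ` S"
      using U unfolding pullback_complex_def by blast
    obtain T \<tau> where T: "V = T \<inter> f -` \<tau>" "T \<in> K" "\<tau> \<in> L"
      using U unfolding pullback_complex_def by blast
    note fS = f(1)[OF S(2)] KD(2)[OF S(2)] f(2)[OF S(2)]
    \<comment> \<open>\<open>U \<inter> V\<close> is cut out of \<open>U\<close> by two faces of \<open>U\<close>: one comes from the common face \<open>S \<inter> T\<close> of the
      domain simplices, the other from the common face \<open>\<sigma> \<inter> \<tau>\<close> of the target simplices.\<close>
    have "(S \<inter> T) \<inter> (S \<inter> f -` \<sigma>) face_of S \<inter> (S \<inter> f -` \<sigma>)"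
      using KD(6)[OF S(2) T(2)] fS LD(2)[OF S(3)]
      by (intro face_of_slice convex_affine_preimage)
    then have "S \<inter> T \<inter> f -` \<sigma> face_of U"
      unfolding S(1) by (simp add: inf.assoc inf.left_commute)
    moreover have "S \<inter> f -` (\<sigma> \<inter> \<tau>) face_of U"
      unfolding S(1) using LD(6)[OF S(3) T(3)] by (intro face_of_affine_preimage fS)
    ultimately have "(S \<inter> T \<inter> f -` \<sigma>) \<inter> (S \<inter> f -` (\<sigma> \<inter> \<tau>)) face_of U" by (rule face_of_Int)
    moreover have "(S \<inter> T \<inter> f -` \<sigma>) \<inter> (S \<inter> f -` (\<sigma> \<inter> \<tau>)) = U \<inter> V" using S(1) T(1) by blast
    ultimately show ?thesis by simp
  qed
qed

text \<open>
  A target complex in which every image \<open>f ` S\<close> is a union of simplices can be pulled back without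
  losing any point of the domain; on the pullback, \<open>f\<close> is simplicial.
\<close>

lemma simplicial_subdivision_of_map:
  fixes f :: "'a::euclidean_space \<Rightarrow> 'b::euclidean_space"
  assumes K: "simplicial_complex K"
    and f: "\<And>S. S \<in> K \<Longrightarrow> affine_map_on S f" "\<And>S. S \<in> K \<Longrightarrow> inj_on f S"
  obtains K' L where "simplicial_complex K'" "simplicial_complex L" "\<Union>K' = \<Union>K"
    "\<And>S. S \<in> K' \<Longrightarrow> affine_map_on S f" "\<And>S. S \<in> K' \<Longrightarrow> inj_on f S" "\<And>S. S \<in> K' \<Longrightarrow> f ` S \<in> L"
proof -
  note KD = simplicial_complexD[OF K]
  have poly: "polytope (f ` S)" if S: "S \<in> K" for S
  proof -
    obtain A b where "linear A" and fA: "\<And>x. x \<in> S \<Longrightarrow> f x = A x + b"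
      using f(1)[OF S] unfolding affine_map_on_def by blast
    then have "f ` S = (\<lambda>y. b + y) ` (A ` S)" by (simp add: image_image add.commute cong: image_cong)
    then show ?thesis
      using KD(4)[OF S] \<open>linear A\<close> by (simp add: polytope_linear_image polytope_translation_eq)
  qed
  obtain L where L: "simplicial_complex L"
    and cov: "\<And>p x. p \<in> (`) f ` K \<Longrightarrow> x \<in> p \<Longrightarrow> \<exists>\<sigma>\<in>L. x \<in> \<sigma> \<and> \<sigma> \<subseteq> p"
    using simplicial_complex_refining_polytopes[of "(`) f ` K"] KD(1) poly by blast
  show thesis
  proof (rule that[OF simplicial_complex_pullback[OF K L f] L])
    show "\<Union>(pullback_complex f K L) = \<Union>K"
    proof
      show "\<Union>(pullback_complex f K L) \<subseteq> \<Union>K" unfolding pullback_complex_def by blast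
      show "\<Union>K \<subseteq> \<Union>(pullback_complex f K L)"
      proof
        fix x assume "x \<in> \<Union>K"
        then obtain S where S: "S \<in> K" "x \<in> S" by blast
        then obtain \<sigma> where "\<sigma> \<in> L" "f x \<in> \<sigma>" "\<sigma> \<subseteq> f ` S" using cov[of "f ` S" "f x"] by blast
        then have "x \<in> S \<inter> f -` \<sigma>" "S \<inter> f -` \<sigma> \<in> pullback_complex f K L"
          using S unfolding pullback_complex_def by blast+
        then show "x \<in> \<Union>(pullback_complex f K L)" by blast
      qed
    qed
    fix U assume "U \<in> pullback_complex f K L"
    then obtain S \<sigma> where S: "U = S \<inter> f -` \<sigma>" "S \<in> K" "\<sigma> \<in> L" "\<sigma> \<subseteq> f ` S"
      unfolding pullback_complex_def by blast
    show "affine_map_on U f" using affine_map_on_subset[OF f(1)[OF S(2)]] S by blast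
    show "inj_on f U" using inj_on_subset[OF f(2)[OF S(2)]] S by blast
    have "f ` U = \<sigma>" using S by blast
    then show "f ` U \<in> L" using S by simp
  qed
qed

section \<open>Extending a function from the vertices\<close>

lemma affine_extension:
  fixes g :: "'a::euclidean_space \<Rightarrow> 'b::euclidean_space"
  assumes "\<not> affine_dependent C"
  obtains h where "affine_map_on UNIV h" "\<And>c. c \<in> C \<Longrightarrow> h c = g c"
proof (cases "C = {}")
  case True
  have "affine_map_on UNIV (\<lambda>x::'a. 0::'b)"
    unfolding affine_map_on_def by (intro exI[of _ "\<lambda>x. 0"] exI[of _ 0]) (simp add: linear_zero)
  then show thesis using that True by blast
next
  case False
  then obtain a where a: "a \<in> C" by blast
  then have "independent ((\<lambda>x. -a + x) ` (C - {a}))"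
    using affine_dependent_iff_dependent2[OF a] assms by blast
  then obtain A where A: "linear A"
    "\<And>x. x \<in> (\<lambda>x. -a + x) ` (C - {a}) \<Longrightarrow> A x = g (x + a) - g a"
    using linear_independent_extend[of _ "\<lambda>x. g (x + a) - g a"] by blast
  let ?h = "\<lambda>x. A x + (g a - A a)"
  show thesis
  proof (rule that[of ?h])
    show "affine_map_on UNIV ?h" unfolding affine_map_on_def using A(1) by blast
    fix c assume c: "c \<in> C"
    show "?h c = g c"
    proof (cases "c = a")
      case False
      then have "A (-a + c) = g c - g a" using c A(2)[of "-a + c"] by simp
      then show ?thesis using A(1) by (simp add: linear_add linear_neg linear_diff algebra_simps)
    qed simp
  qed
qed

text \<open>
  The spanning points of a simplex are its extreme points, hence its zero-dimensional faces. So
  being a vertex is a property of the complex, the same for all simplices containing the point.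
\<close>

lemma simplex_in_complex_vertices:
  assumes "simplicial_complex K" "S \<in> K"
  obtains C where "finite C" "\<not> affine_dependent C" "S = convex hull C" "\<And>v. v \<in> C \<longleftrightarrow> v \<in> S \<and> {v} \<in> K"
proof -
  obtain C where C: "finite C" "\<not> affine_dependent C" "S = convex hull C"
    using assms unfolding simplicial_complex_def simplex by blast
  have ext: "{v} face_of S \<longleftrightarrow> v \<in> C" for v
    using extreme_point_of_convex_hull_affine_independent[OF C(2), of v] C(3)
    by (simp add: face_of_singleton)
  have "v \<in> C \<longleftrightarrow> v \<in> S \<and> {v} \<in> K" for v
  proof
    assume v: "v \<in> C"
    then show "v \<in> S \<and> {v} \<in> K"
      using ext simplicial_complexD(5)[OF assms] C(3) hull_subset[of C convex] by blast
  next
    assume v: "v \<in> S \<and> {v} \<in> K"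
    then have "S \<inter> {v} face_of S" using simplicial_complexD(6)[OF assms] by blast
    moreover have "S \<inter> {v} = {v}" using v by blast
    ultimately show "v \<in> C" using ext by simp
  qed
  then show thesis using that C by blast
qed

lemma affine_maps_agree_on_hull:
  assumes "affine_map_on S g" "affine_map_on S h" "finite C" "convex hull C \<subseteq> S"
    "\<And>c. c \<in> C \<Longrightarrow> g c = h c" "x \<in> convex hull C"
  shows "g x = h x"
proof -
  obtain u where u: "sum u C = 1" "(\<Sum>c\<in>C. u c *\<^sub>R c) = x"
    using assms(3,6) convex_hull_finite[of C] by auto
  have CS: "C \<subseteq> S" using assms(4) hull_subset[of C convex] by blast
  have "x \<in> S" using assms by blast
  have "g x = (\<Sum>c\<in>C. u c *\<^sub>R g c)" "h x = (\<Sum>c\<in>C. u c *\<^sub>R h c)"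
    using affine_map_on_sum[OF assms(1), of C "\<lambda>c. c" u] affine_map_on_sum[OF assms(2), of C "\<lambda>c. c" u]
      u CS \<open>x \<in> S\<close> by auto
  then show ?thesis using assms(5) by simp
qed

text \<open>
  The affine extensions over two simplices agree on their intersection, because this is again
  a simplex of the complex and its vertices are vertices of both.
\<close>

lemma simplicial_extension:
  fixes g0 :: "'a::euclidean_space \<Rightarrow> 'b::euclidean_space"
  assumes K: "simplicial_complex K"
  obtains g where "\<And>S. S \<in> K \<Longrightarrow> affine_map_on S g" "\<And>v. {v} \<in> K \<Longrightarrow> g v = g0 v"
proof -
  have "\<exists>h. affine_map_on UNIV h \<and> (\<forall>v\<in>S. {v} \<in> K \<longrightarrow> h v = g0 v)" if S: "S \<in> K" for S
    using simplex_in_complex_vertices[OF K S] affine_extension[of _ g0] by metis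
  then obtain h where h: "\<And>S. S \<in> K \<Longrightarrow> affine_map_on UNIV (h S)"
    "\<And>S v. S \<in> K \<Longrightarrow> v \<in> S \<Longrightarrow> {v} \<in> K \<Longrightarrow> h S v = g0 v" by metis
  have agree: "h S x = h T x" if ST: "S \<in> K" "T \<in> K" "x \<in> S" "x \<in> T" for S T x
  proof -
    obtain C where C: "finite C" "S \<inter> T = convex hull C" "\<And>v. v \<in> C \<longleftrightarrow> v \<in> S \<inter> T \<and> {v} \<in> K"
      using simplex_in_complex_vertices[OF K simplicial_complexD(7)[OF K ST(1,2)]] by metis
    show ?thesis
    proof (rule affine_maps_agree_on_hull[OF h(1)[OF ST(1)] h(1)[OF ST(2)] C(1)])
      show "h S c = h T c" if "c \<in> C" for c
        using that C(3)[of c] h(2) ST(1,2) by simp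
      show "x \<in> convex hull C" using C(2) ST(3,4) by blast
    qed simp
  qed
  define g where "g x = h (SOME S. S \<in> K \<and> x \<in> S) x" for x
  have g: "g x = h S x" if "S \<in> K" "x \<in> S" for S x
  proof -
    have "(SOME S. S \<in> K \<and> x \<in> S) \<in> K \<and> x \<in> (SOME S. S \<in> K \<and> x \<in> S)"
      using that by (intro someI[of "\<lambda>S. S \<in> K \<and> x \<in> S"]) blast
    then show ?thesis unfolding g_def using agree that by blast
  qed
  show thesis
  proof (rule that)
    fix S assume S: "S \<in> K"
    have "affine_map_on S (h S)" using h(1)[OF S] affine_map_on_subset by blast
    then show "affine_map_on S g" using g[OF S] unfolding affine_map_on_def by auto
  next
    fix v assume "{v} \<in> K"
    then show "g v = g0 v" using g[of "{v}" v] h(2)[of "{v}" v] by simp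
  qed
qed


section \<open>The double points\<close>

lemma double_points_iff: "(x, y) \<in> double_points X f \<longleftrightarrow> x \<in> X \<and> y \<in> X \<and> x \<noteq> y \<and> f x = f y"
  unfolding double_points_def deleted_square_def by auto

lemma triple_points_iff:
  "(x, y, z) \<in> triple_points X f \<longleftrightarrow>
     (x, y) \<in> double_points X f \<and> (y, z) \<in> double_points X f \<and> (z, x) \<in> double_points X f"
  unfolding triple_points_def deleted_cube_def double_points_iff by auto

lemma equivariant_signD:
  assumes "equivariant_sign X f \<phi>" "(x, y) \<in> double_points X f"
  shows "\<phi> (x, y) = 1 \<or> \<phi> (x, y) = -1" "\<phi> (y, x) = - \<phi> (x, y)"
proof -
  show "\<phi> (x, y) = 1 \<or> \<phi> (x, y) = -1"
    using assms unfolding equivariant_sign_def sphere0_def by blast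
  have "\<phi> (prod.swap (x, y)) = - \<phi> (x, y)"
    using assms unfolding equivariant_sign_def by blast
  then show "\<phi> (y, x) = - \<phi> (x, y)" by simp
qed

lemma face_of_convex_combination:
  assumes "F face_of S" "x \<in> S" "y \<in> S" "(1 - u) *\<^sub>R x + u *\<^sub>R y \<in> F" "0 < u" "u < 1"
  shows "x \<in> F \<and> y \<in> F"
proof (cases "x = y")
  case True
  then show ?thesis using assms(4) by (simp add: algebra_simps)
next
  case False
  then have "(1 - u) *\<^sub>R x + u *\<^sub>R y \<in> open_segment x y"
    using assms(5,6) in_segment(2) by blast
  then show ?thesis using assms unfolding face_of_def by blast
qed

text \<open>
  Removing the diagonal from a convex set of pairs generally destroys convexity. It does not do so
  here, because the diagonal meets \<open>S \<times> T\<close> inside the product of the common face \<open>S \<inter> T\<close> with itself: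
  a combination that reaches the diagonal already has its end points there, and \<open>f\<close> is
  injective on that face.
\<close>

lemma convex_double_point_cell:
  assumes K: "simplicial_complex K"
    and f: "\<And>S. S \<in> K \<Longrightarrow> affine_map_on S f" "\<And>S. S \<in> K \<Longrightarrow> inj_on f S"
    and ST: "S \<in> K" "T \<in> K"
  shows "convex {(x, y). x \<in> S \<and> y \<in> T \<and> x \<noteq> y \<and> f x = f y}"
  unfolding convex_alt
proof (intro ballI allI impI)
  note KD = simplicial_complexD[OF K]
  fix p q :: "'a \<times> 'a" and u :: real
  assume "p \<in> {(x, y). x \<in> S \<and> y \<in> T \<and> x \<noteq> y \<and> f x = f y}"
    "q \<in> {(x, y). x \<in> S \<and> y \<in> T \<and> x \<noteq> y \<and> f x = f y}"
  then obtain x y x' y' where pq: "p = (x, y)" "q = (x', y')"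
    and x: "x \<in> S" "x' \<in> S" and y: "y \<in> T" "y' \<in> T"
    and ne: "x \<noteq> y" "x' \<noteq> y'" and eq: "f x = f y" "f x' = f y'"
    by auto
  assume u: "0 \<le> u \<and> u \<le> 1"
  let ?z = "(1 - u) *\<^sub>R x + u *\<^sub>R x'" and ?w = "(1 - u) *\<^sub>R y + u *\<^sub>R y'"
  have z: "?z \<in> S" using KD(2)[OF ST(1)] x u unfolding convex_alt by blast
  have w: "?w \<in> T" using KD(2)[OF ST(2)] y u unfolding convex_alt by blast
  have "f ?z = f ?w"
    using affine_map_on_segment[OF f(1)[OF ST(1)] x z] affine_map_on_segment[OF f(1)[OF ST(2)] y w] eq
    by simp
  moreover have "?z \<noteq> ?w"
  proof
    assume zw: "?z = ?w"
    show False
    proof (cases "u = 0 \<or> u = 1")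
      case True
      then show False using zw ne by auto
    next
      case False
      then have u: "0 < u" "u < 1" using u by auto
      have "x \<in> S \<inter> T \<and> x' \<in> S \<inter> T"
        using face_of_convex_combination[OF KD(6)[OF ST] x _ u] z w zw by simp
      moreover have "y \<in> T \<inter> S \<and> y' \<in> T \<inter> S"
        using face_of_convex_combination[OF KD(6)[OF ST(2,1)] y _ u] z w zw by simp
      ultimately show False using inj_onD[OF f(2)[OF ST(1)] eq(1)] ne(1) by blast
    qed
  qed
  ultimately show "(1 - u) *\<^sub>R p + u *\<^sub>R q \<in> {(x, y). x \<in> S \<and> y \<in> T \<and> x \<noteq> y \<and> f x = f y}"
    using z w by (simp add: pq)
qed

lemma equivariant_sign_constant_on_cell:
  fixes X :: "'a::euclidean_space set" and f :: "'a \<Rightarrow> 'b::real_vector"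
  assumes K: "simplicial_complex K" "\<Union>K = X"
    and f: "\<And>S. S \<in> K \<Longrightarrow> affine_map_on S f" "\<And>S. S \<in> K \<Longrightarrow> inj_on f S"
    and \<phi>: "equivariant_sign X f \<phi>"
    and ST: "S \<in> K" "T \<in> K"
    and x: "x \<in> S" "x' \<in> S" and y: "y \<in> T" "y' \<in> T"
    and D: "(x, y) \<in> double_points X f" "(x', y') \<in> double_points X f"
  shows "\<phi> (x, y) = \<phi> (x', y')"
proof -
  let ?C = "{(x, y). x \<in> S \<and> y \<in> T \<and> x \<noteq> y \<and> f x = f y}"
  have C: "?C \<subseteq> double_points X f"
    using K(2) ST by (auto simp: double_points_iff)
  have "\<phi> constant_on ?C"
  proof (rule continuous_finite_range_constant)
    show "connected ?C" using convex_double_point_cell[OF K(1) f ST] by (rule convex_connected)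
    show "continuous_on ?C \<phi>" using \<phi> C continuous_on_subset unfolding equivariant_sign_def by blast
    have "\<phi> ` ?C \<subseteq> {1, -1}" using \<phi> C unfolding equivariant_sign_def sphere0_def by blast
    then show "finite (\<phi> ` ?C)" by (rule finite_subset) simp
  qed
  then obtain r where r: "\<And>p. p \<in> ?C \<Longrightarrow> \<phi> p = r" unfolding constant_on_def by blast
  have "(x, y) \<in> ?C" "(x', y') \<in> ?C" using x y D by (simp_all add: double_points_iff)
  then show ?thesis using r[of "(x, y)"] r[of "(x', y')"] by simp
qed

text \<open>
  A sign is determined by the set of cells on which it is 1. Signs are restricted to the double
  points, since their values elsewhere are arbitrary.
\<close>

lemma finite_equivariant_signs:
  fixes X :: "'a::euclidean_space set" and f :: "'a \<Rightarrow> 'b::real_vector"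
  assumes K: "simplicial_complex K" "\<Union>K = X"
    and f: "\<And>S. S \<in> K \<Longrightarrow> affine_map_on S f" "\<And>S. S \<in> K \<Longrightarrow> inj_on f S"
  shows "finite ((\<lambda>\<phi>. restrict \<phi> (double_points X f)) ` {\<phi>. equivariant_sign X f \<phi>})"
proof (rule finite_subset)
  let ?D = "double_points X f"
  define sgn_on :: "('a set \<times> 'a set) set \<Rightarrow> 'a \<times> 'a \<Rightarrow> real"
    where "sgn_on Q = restrict (\<lambda>p. if \<exists>(S, T)\<in>Q. p \<in> S \<times> T then 1 else -1) ?D" for Q
  show "finite (sgn_on ` Pow (K \<times> K))" using simplicial_complexD(1)[OF K(1)] by simp
  show "(\<lambda>\<phi>. restrict \<phi> ?D) ` {\<phi>. equivariant_sign X f \<phi>} \<subseteq> sgn_on ` Pow (K \<times> K)"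
  proof clarify
    fix \<phi> assume \<phi>: "equivariant_sign X f \<phi>"
    define Q where "Q = {(S, T)\<in>K \<times> K. \<exists>p\<in>?D \<inter> S \<times> T. \<phi> p = 1}"
    have "\<phi> (x, y) = sgn_on Q (x, y)" if xy: "(x, y) \<in> ?D" for x y
    proof (cases "\<phi> (x, y) = 1")
      case True
      obtain S T where "S \<in> K" "T \<in> K" "x \<in> S" "y \<in> T"
        using xy K(2) unfolding double_points_iff by blast
      then have "(S, T) \<in> Q" "(x, y) \<in> S \<times> T" unfolding Q_def using xy True by auto
      then show ?thesis unfolding sgn_on_def using xy True by auto
    next
      case False
      have "(x, y) \<notin> S \<times> T" if "(S, T) \<in> Q" for S T
      proof
        assume m: "(x, y) \<in> S \<times> T"
        obtain x' y' where "S \<in> K" "T \<in> K" "(x', y') \<in> ?D" "x' \<in> S" "y' \<in> T" "\<phi> (x', y') = 1"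
          using \<open>(S, T) \<in> Q\<close> unfolding Q_def by auto
        then have "\<phi> (x, y) = 1"
          using equivariant_sign_constant_on_cell[OF K f \<phi>, of S T x x' y y'] xy m by auto
        then show False using False by simp
      qed
      then have "\<not> (\<exists>(S, T)\<in>Q. (x, y) \<in> S \<times> T)" by blast
      then have "sgn_on Q (x, y) = -1" unfolding sgn_on_def using xy by simp
      then show ?thesis using equivariant_signD(1)[OF \<phi> xy] False by simp
    qed
    then have "restrict \<phi> ?D = sgn_on Q"
      unfolding sgn_on_def by (auto simp: restrict_def fun_eq_iff)
    moreover have "Q \<in> Pow (K \<times> K)" unfolding Q_def by auto
    ultimately show "restrict \<phi> ?D \<in> sgn_on ` Pow (K \<times> K)" by blast
  qed
qed

lemma equivariant_sign_sgn:
  fixes h :: "'a::topological_space \<times> 'a \<Rightarrow> real"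
  assumes "continuous_on (double_points X f) h"
    and "\<And>p. p \<in> double_points X f \<Longrightarrow> h p \<noteq> 0"
    and "\<And>p. p \<in> double_points X f \<Longrightarrow> h (prod.swap p) = - h p"
  shows "equivariant_sign X f (\<lambda>p. sgn (h p))"
  unfolding equivariant_sign_def
proof (intro conjI ballI)
  show "continuous_on (double_points X f) (\<lambda>p. sgn (h p))"
    using assms(1,2) by (intro continuous_on_sgn) blast+
  show "(\<lambda>p. sgn (h p)) \<in> double_points X f \<rightarrow> sphere0"
    using assms(2) unfolding sphere0_def by (simp add: sgn_real_def)
  show "sgn (h (prod.swap p)) = - sgn (h p)" if "p \<in> double_points X f" for p
    using assms(3)[OF that] by (simp add: sgn_minus)
qed

section \<open>Heights\<close>

text \<open>
  The comparison of \<open>g x\<close> and \<open>g y\<close> reduces to vertices: over the simplex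
  \<open>f ` S \<inter> f ` T\<close> with vertex set \<open>C\<close>, the sections \<open>s\<close> and \<open>t\<close> into \<open>S\<close> and \<open>T\<close> give \<open>x\<close> and \<open>y\<close>
  as combinations of \<open>s c\<close> and of \<open>t c\<close> with the same coefficients.
\<close>

lemma height_from_transitive_sign:
  fixes X :: "'a::euclidean_space set" and f :: "'a \<Rightarrow> 'b::euclidean_space"
  assumes K: "simplicial_complex K" "\<Union>K = X" and L: "simplicial_complex L"
    and f: "\<And>S. S \<in> K \<Longrightarrow> affine_map_on S f" "\<And>S. S \<in> K \<Longrightarrow> inj_on f S" "\<And>S. S \<in> K \<Longrightarrow> f ` S \<in> L"
    and \<phi>: "equivariant_sign X f \<phi>"
    and tr: "\<And>x y z. (x, y) \<in> double_points X f \<Longrightarrow> (y, z) \<in> double_points X f \<Longrightarrow>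
       \<phi> (x, y) = 1 \<Longrightarrow> \<phi> (y, z) = 1 \<Longrightarrow> (x, z) \<in> double_points X f \<and> \<phi> (x, z) = 1"
  obtains g :: "'a \<Rightarrow> real" where "\<And>S. S \<in> K \<Longrightarrow> affine_map_on S g"
    "\<And>x y. (x, y) \<in> double_points X f \<Longrightarrow> \<phi> (x, y) = 1 \<Longrightarrow> g x < g y"
proof -
  note KD = simplicial_complexD[OF K(1)] and LD = simplicial_complexD[OF L]
  let ?D = "double_points X f"
  define V where "V = {v. {v} \<in> K}"
  have finV: "finite V"
    using finite_vimageI[OF KD(1), of "\<lambda>v. {v}"] by (simp add: V_def vimage_def inj_def)
  define below where "below v = {u \<in> V. (u, v) \<in> ?D \<and> \<phi> (u, v) = 1}" for v
  have below: "card (below v) < card (below v')"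
    if v: "v \<in> V" "(v, v') \<in> ?D" "\<phi> (v, v') = 1" for v v'
  proof (rule psubset_card_mono)
    show "finite (below v')" unfolding below_def using finV by simp
    have "below v \<subseteq> below v'" unfolding below_def using tr v by blast
    moreover have "v \<in> below v'" using v unfolding below_def by simp
    moreover have "v \<notin> below v" unfolding below_def double_points_iff by simp
    ultimately show "below v \<subset> below v'" by blast
  qed
  obtain g :: "'a \<Rightarrow> real" where g: "\<And>S. S \<in> K \<Longrightarrow> affine_map_on S g"
    "\<And>v. {v} \<in> K \<Longrightarrow> g v = real (card (below v))"
    using simplicial_extension[OF K(1), of "\<lambda>v. real (card (below v))"] by blast
  show thesis
  proof (rule that[OF g(1)])
    fix x y assume xy: "(x, y) \<in> ?D" and pos: "\<phi> (x, y) = 1"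
    then have XY: "x \<in> X" "y \<in> X" "x \<noteq> y" "f x = f y" by (auto simp: double_points_iff)
    obtain S T where S: "S \<in> K" "x \<in> S" and T: "T \<in> K" "y \<in> T" using XY K(2) by blast
    note fS = f(1)[OF S(1)] KD(2)[OF S(1)] f(2)[OF S(1)]
      and fT = f(1)[OF T(1)] KD(2)[OF T(1)] f(2)[OF T(1)]
    have "f ` S \<inter> f ` T \<in> L" using LD(7) f(3) S(1) T(1) by blast
    then obtain C where C: "finite C" "f ` S \<inter> f ` T = convex hull C"
      "\<And>c. c \<in> C \<longleftrightarrow> c \<in> f ` S \<inter> f ` T \<and> {c} \<in> L"
      using simplex_in_complex_vertices[OF L] by metis
    have "f x \<in> f ` S \<inter> f ` T" using S(2) T(2) XY(4) by (metis IntI imageI)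
    then have "f x \<in> convex hull C" using C(2) by simp
    then obtain u where u: "\<And>c. c \<in> C \<Longrightarrow> 0 \<le> u c" "sum u C = 1" "(\<Sum>c\<in>C. u c *\<^sub>R c) = f x"
      using C(1) convex_hull_finite[of C] by auto
    define s where "s = inv_into S f"
    define t where "t = inv_into T f"
    have s: "s c \<in> S" "f (s c) = c" and t: "t c \<in> T" "f (t c) = c" if "c \<in> C" for c
      using C(3) that unfolding s_def t_def by (auto simp: inv_into_into f_inv_into_f)
    have xs: "x = (\<Sum>c\<in>C. u c *\<^sub>R s c)"
      unfolding s_def using C u S(2) by (intro affine_section_combination[OF fS]) auto
    have yt: "y = (\<Sum>c\<in>C. u c *\<^sub>R t c)"
      unfolding t_def using C u T(2) XY(4) by (intro affine_section_combination[OF fT]) auto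
    have gx: "g x = (\<Sum>c\<in>C. u c *\<^sub>R g (s c))"
      unfolding xs using affine_map_on_sum[OF g(1)[OF S(1)] _ u(2), of s] s S(2) xs by simp
    have gy: "g y = (\<Sum>c\<in>C. u c *\<^sub>R g (t c))"
      unfolding yt using affine_map_on_sum[OF g(1)[OF T(1)] _ u(2), of t] t T(2) yt by simp
    \<comment> \<open>Heights were prescribed at vertices only, so \<open>s c\<close> and \<open>t c\<close> must be vertices of \<open>K\<close>.\<close>
    have vertex: "{v} \<in> K" if v: "R \<in> K" "v \<in> R" "{f v} \<in> L" for R v
    proof -
      have "f ` R \<inter> {f v} face_of f ` R" using LD(6) f(3) v by blast
      then have "{f v} face_of f ` R" using v(2) by (simp add: insert_absorb Int_absorb1)
      then have "R \<inter> f -` {f v} face_of R \<inter> f -` (f ` R)"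
        using face_of_affine_preimage[OF f(1) KD(2) f(2)] v(1) by blast
      moreover have "R \<inter> f -` {f v} = {v}" "R \<inter> f -` (f ` R) = R"
        using f(2)[OF v(1)] v(2) by (auto dest: inj_onD)
      ultimately show ?thesis using KD(5)[OF v(1)] by simp
    qed
    have less: "g (s c) < g (t c)" if c: "c \<in> C" "s c \<noteq> t c" for c
    proof -
      have D: "(s c, t c) \<in> ?D"
        using s[OF c(1)] t[OF c(1)] c S T K(2) by (auto simp: double_points_iff)
      then have "\<phi> (s c, t c) = 1"
        using equivariant_sign_constant_on_cell[OF K f(1,2) \<phi> S(1) T(1) s(1)[OF c(1)] S(2) t(1)[OF c(1)] T(2) D xy]
          pos by simp
      moreover have "{s c} \<in> K" "{t c} \<in> K"
        using vertex[OF S(1) s(1)[OF c(1)]] vertex[OF T(1) t(1)[OF c(1)]] s(2) t(2) C(3) c(1) by auto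
      ultimately show ?thesis using below[of "s c" "t c"] D g(2) unfolding V_def by simp
    qed
    \<comment> \<open>Some pair of corresponding vertices is distinct and has positive weight, since \<open>x \<noteq> y\<close>;
      this makes the averaged inequality strict.\<close>
    have "\<exists>c\<in>C. u c \<noteq> 0 \<and> s c \<noteq> t c"
    proof (rule ccontr)
      assume "\<not> ?thesis"
      then have "(\<Sum>c\<in>C. u c *\<^sub>R s c) = (\<Sum>c\<in>C. u c *\<^sub>R t c)" by (intro sum.cong) auto
      then show False using xs yt XY(3) by simp
    qed
    then obtain c where c: "c \<in> C" "u c \<noteq> 0" "s c \<noteq> t c" by blast
    show "g x < g y"
      unfolding gx gy
    proof (rule sum_strict_mono_ex1[OF C(1)])
      show "\<forall>c\<in>C. u c *\<^sub>R g (s c) \<le> u c *\<^sub>R g (t c)"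
      proof
        fix c assume c: "c \<in> C"
        then have "g (s c) \<le> g (t c)" using less[of c] by (cases "s c = t c") auto
        then show "u c *\<^sub>R g (s c) \<le> u c *\<^sub>R g (t c)" using u(1)[OF c] by (simp add: mult_left_mono)
      qed
      have "0 < u c" using u(1)[OF c(1)] c(2) by simp
      then have "u c *\<^sub>R g (s c) < u c *\<^sub>R g (t c)" using less[OF c(1,3)] by simp
      then show "\<exists>c\<in>C. u c *\<^sub>R g (s c) < u c *\<^sub>R g (t c)" using c(1) by blast
    qed
  qed
qed

text \<open>
  If an affine map identifies two points of a convex set, it is constant on the segment
  joining them, and this segment is a 1-simplex inside a fibre.
\<close>

lemma non_degenerate_inj_on:
  fixes f :: "'a::euclidean_space \<Rightarrow> 'b::euclidean_space"
  assumes "non_degenerate X Y f" "f \<in> X \<rightarrow> Y" "S \<subseteq> X" "convex S" "affine_map_on S f"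
  shows "inj_on f S"
proof (rule inj_onI, rule ccontr)
  fix x y assume xy: "x \<in> S" "y \<in> S" "f x = f y" "x \<noteq> y"
  let ?F = "fibre X f (f x)"
  have "closed_segment x y \<subseteq> ?F"
  proof
    fix z assume z: "z \<in> closed_segment x y"
    then have "z \<in> S" using \<open>convex S\<close> xy closed_segment_subset by blast
    moreover obtain u where u: "z = (1 - u) *\<^sub>R x + u *\<^sub>R y" using z in_segment(1) by blast
    ultimately have "f z = (1 - u) *\<^sub>R f x + u *\<^sub>R f y"
      using affine_map_on_segment[OF assms(5) xy(1,2), of u] by simp
    also have "\<dots> = f x" using xy(3) by (simp flip: scaleR_add_left)
    finally show "z \<in> ?F" using \<open>z \<in> S\<close> \<open>S \<subseteq> X\<close> unfolding fibre_def by blast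
  qed
  then have "1 \<in> {n. \<exists>S. n simplex S \<and> S \<subseteq> ?F}" using one_simplex_segment[OF xy(4)] by blast
  moreover have "bdd_above {n. \<exists>S. n simplex S \<and> S \<subseteq> ?F}"
  proof (rule bdd_aboveI)
    fix n assume "n \<in> {n. \<exists>S. n simplex S \<and> S \<subseteq> ?F}"
    then obtain S :: "'a set" where "n simplex S" by blast
    then have "n = aff_dim S" by (simp add: aff_dim_simplex)
    then show "n \<le> int DIM('a)" by (simp add: aff_dim_le_DIM)
  qed
  ultimately have "1 \<le> poly_dim ?F" unfolding poly_dim_def by (rule cSup_upper)
  moreover have "f x \<in> Y" using assms(2,3) xy(1) by blast
  ultimately show False using assms(1) unfolding non_degenerate_def by fastforce
qed

lemma simplexwise_affine_imp_continuous_on: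
  fixes f :: "'a::euclidean_space \<Rightarrow> 'b::euclidean_space"
  assumes "simplicial_complex K" "\<And>S. S \<in> K \<Longrightarrow> affine_map_on S f"
  shows "continuous_on (\<Union>K) f"
proof -
  have "continuous_on (\<Union>S\<in>K. S) f"
    using simplicial_complexD(1,3)[OF assms(1)] affine_map_on_imp_continuous_on[OF assms(2)]
    by (intro continuous_on_closed_Union) (auto intro: compact_imp_closed)
  then show ?thesis by simp
qed

section \<open>The equivalences\<close>

lemma pl_1_prem_imp_height:
  assumes "pl_1_prem X Y f"
  shows "\<exists>g::'a::euclidean_space \<Rightarrow> real. continuous_on X g \<and> (\<forall>x y. (x, y) \<in> double_points X f \<longrightarrow> g x \<noteq> g y)"
proof -
  obtain g :: "'a \<Rightarrow> real" and h where g: "continuous_on X g" "homeomorphism X ((\<lambda>x. (f x, g x)) ` X) (\<lambda>x. (f x, g x)) h"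
    using assms unfolding pl_1_prem_def pl_embedding_def by blast
  have "g x \<noteq> g y" if xy: "(x, y) \<in> double_points X f" for x y
  proof
    assume "g x = g y"
    then have "h (f x, g x) = h (f y, g y)" using xy by (simp add: double_points_iff)
    then show False using g(2) xy unfolding homeomorphism_def double_points_iff by metis
  qed
  then show ?thesis using g(1) by blast
qed

lemma continuous_on_double_points:
  assumes "continuous_on X g"
  shows "continuous_on (double_points X f) (\<lambda>p. g (fst p))" "continuous_on (double_points X f) (\<lambda>p. g (snd p))"
  by (rule continuous_on_compose2[OF assms], auto simp: double_points_iff intro!: continuous_intros)+

lemma height_imp_equivariant_sign:
  fixes g :: "'a::topological_space \<Rightarrow> real"
  assumes "continuous_on X g" "\<And>x y. (x, y) \<in> double_points X f \<Longrightarrow> g x \<noteq> g y"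
  shows "equivariant_sign X f (\<lambda>(x, y). sgn (g y - g x))"
proof -
  have "equivariant_sign X f (\<lambda>p. sgn (g (snd p) - g (fst p)))"
    using assms by (intro equivariant_sign_sgn continuous_on_diff continuous_on_double_points) force+
  then show ?thesis by (simp add: case_prod_unfold)
qed

lemma height_imp_fibre_order:
  fixes g :: "'a \<Rightarrow> real"
  assumes "\<And>x y. (x, y) \<in> double_points X f \<Longrightarrow> g x \<noteq> g y"
  shows "linear_order_on (fibre X f y) {(x, x'). x \<in> fibre X f y \<and> x' \<in> fibre X f y \<and> g x \<le> g x'}"
proof -
  have "x = x'" if "x \<in> fibre X f y" "x' \<in> fibre X f y" "g x = g x'" for x x'
    using assms[of x x'] that by (auto simp: double_points_iff fibre_def)
  then show ?thesis
    unfolding order_on_defs by (auto simp: refl_on_def trans_def antisym_def total_on_def)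
qed

lemma height_imp_equivariant_maps:
  fixes g :: "'a::topological_space \<Rightarrow> real"
  assumes g: "continuous_on X g" "\<And>x y. (x, y) \<in> double_points X f \<Longrightarrow> g x \<noteq> g y"
  shows "S2_map (double_points X f) (deleted_square UNIV) (map_prod g g)"
    and "S3_map (triple_points X f) (deleted_cube UNIV) (map_prod g (map_prod g g))"
    and "map_prod g g (proj32 j t) = proj32 j (map_prod g (map_prod g g) t)"
proof -
  have coord: "g (coord3 t i) = coord3 (map_prod g (map_prod g g) t) i" for t i
    by (cases t) auto
  show "map_prod g g (proj32 j t) = proj32 j (map_prod g (map_prod g g) t)"
    unfolding proj32_def by (simp add: coord)
  show "S2_map (double_points X f) (deleted_square UNIV) (map_prod g g)"
    unfolding S2_map_def
  proof (intro conjI ballI)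
    show "continuous_on (double_points X f) (map_prod g g)"
      unfolding map_prod_def case_prod_unfold
      by (intro continuous_on_Pair continuous_on_double_points g)
    show "map_prod g g \<in> double_points X f \<rightarrow> deleted_square UNIV"
      using g(2) by (force simp: deleted_square_def)
  qed auto
  show "S3_map (triple_points X f) (deleted_cube UNIV) (map_prod g (map_prod g g))"
    unfolding S3_map_def
  proof (intro conjI allI impI ballI)
    have "continuous_on (triple_points X f) (\<lambda>t. g (fst t))"
      "continuous_on (triple_points X f) (\<lambda>t. g (fst (snd t)))"
      "continuous_on (triple_points X f) (\<lambda>t. g (snd (snd t)))"
      by (rule continuous_on_compose2[OF g(1)],
          auto simp: triple_points_iff double_points_iff intro!: continuous_intros)+
    then show "continuous_on (triple_points X f) (map_prod g (map_prod g g))"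
      unfolding map_prod_def case_prod_unfold by (simp add: continuous_on_Pair)
    show "map_prod g (map_prod g g) \<in> triple_points X f \<rightarrow> deleted_cube UNIV"
      using g(2) unfolding Pi_def split_paired_All by (simp add: deleted_cube_def triple_points_iff)
    show "map_prod g (map_prod g g) (permute3 \<sigma> t) = permute3 \<sigma> (map_prod g (map_prod g g) t)" for \<sigma> t
      unfolding permute3_def by (simp add: coord)
  qed
qed

text \<open>
  A triple on which the three signs agree is a directed 3-cycle of the tournament that the sign
  defines on a fibre.
\<close>

definition acyclic_sign :: "'a set \<Rightarrow> ('a \<Rightarrow> 'b) \<Rightarrow> ('a \<times> 'a \<Rightarrow> real) \<Rightarrow> bool" where
  "acyclic_sign X f \<phi> \<longleftrightarrow>
     (\<forall>x y z. (x, y, z) \<in> triple_points X f \<longrightarrow> \<not> (\<phi> (x, y) = \<phi> (y, z) \<and> \<phi> (y, z) = \<phi> (z, x)))"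

lemma acyclic_sign_iff:
  assumes "equivariant_sign X f \<phi>"
  shows "acyclic_sign X f \<phi> \<longleftrightarrow>
    (\<forall>(x, y, z)\<in>triple_points X f.
       map_prod \<phi> (map_prod \<phi> \<phi>) ((x, y), (y, z), (z, x)) \<in> sphere0 \<times> sphere0 \<times> sphere0 - thin_diagonal sphere0)"
proof -
  have "\<phi> p \<in> sphere0" if "p \<in> double_points X f" for p
    using assms that unfolding equivariant_sign_def by blast
  then have *: "map_prod \<phi> (map_prod \<phi> \<phi>) ((x, y), (y, z), (z, x)) \<in> sphere0 \<times> sphere0 \<times> sphere0 - thin_diagonal sphere0
      \<longleftrightarrow> \<not> (\<phi> (x, y) = \<phi> (y, z) \<and> \<phi> (y, z) = \<phi> (z, x))" if "(x, y, z) \<in> triple_points X f" for x y z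
    using that unfolding thin_diagonal_def triple_points_iff by auto
  show ?thesis
    by (simp only: acyclic_sign_def Ball_def split_paired_All prod.case * cong: imp_cong)
qed

lemma acyclic_sign_transitive:
  assumes \<phi>: "equivariant_sign X f \<phi>" "acyclic_sign X f \<phi>"
    and D: "(x, y) \<in> double_points X f" "(y, z) \<in> double_points X f" and pos: "\<phi> (x, y) = 1" "\<phi> (y, z) = 1"
  shows "(x, z) \<in> double_points X f \<and> \<phi> (x, z) = 1"
proof -
  have "x \<noteq> z" using equivariant_signD(2)[OF \<phi>(1) D(1)] pos by auto
  then have zx: "(z, x) \<in> double_points X f" "(x, z) \<in> double_points X f"
    using D by (auto simp: double_points_iff)
  then have "(x, y, z) \<in> triple_points X f" using D by (simp add: triple_points_iff)
  then have "\<phi> (z, x) \<noteq> 1" using \<phi>(2) pos unfolding acyclic_sign_def by metis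
  then have "\<phi> (x, z) = 1"
    using equivariant_signD[OF \<phi>(1) zx(1)] by auto
  then show ?thesis using zx by blast
qed

text \<open>
  On the compact \<open>X\<close> a continuous injection is an embedding, so it suffices that the height
  separates double points; equivariance allows to order each pair so that its sign is 1.
\<close>

lemma acyclic_sign_imp_pl_1_prem:
  fixes X :: "'a::euclidean_space set" and f :: "'a \<Rightarrow> 'b::euclidean_space"
  assumes "pl_map X Y f" "non_degenerate X Y f" and \<phi>: "equivariant_sign X f \<phi>" "acyclic_sign X f \<phi>"
  shows "pl_1_prem X Y f"
proof -
  obtain K0 where K0: "simplicial_complex K0" "\<Union>K0 = X" "\<And>S. S \<in> K0 \<Longrightarrow> affine_map_on S f"
    and fXY: "f \<in> X \<rightarrow> Y"
    using assms(1) unfolding pl_map_def by blast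
  have inj: "inj_on f S" if S: "S \<in> K0" for S
    using non_degenerate_inj_on[OF assms(2) fXY _ simplicial_complexD(2)[OF K0(1) S] K0(3)[OF S]] K0(2) S
    by blast
  obtain K L where K: "simplicial_complex K" "\<Union>K = X" and L: "simplicial_complex L"
    and f: "\<And>S. S \<in> K \<Longrightarrow> affine_map_on S f" "\<And>S. S \<in> K \<Longrightarrow> inj_on f S" "\<And>S. S \<in> K \<Longrightarrow> f ` S \<in> L"
    using simplicial_subdivision_of_map[OF K0(1,3) inj] K0(2) by metis
  obtain g :: "'a \<Rightarrow> real" where g: "\<And>S. S \<in> K \<Longrightarrow> affine_map_on S g"
    "\<And>x y. (x, y) \<in> double_points X f \<Longrightarrow> \<phi> (x, y) = 1 \<Longrightarrow> g x < g y"
    using height_from_transitive_sign[OF K L f \<phi>(1)] acyclic_sign_transitive[OF \<phi>] by metis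
  let ?h = "\<lambda>x. (f x, g x)"
  have h: "\<And>S. S \<in> K \<Longrightarrow> affine_map_on S ?h" using f(1) g(1) affine_map_on_Pair by blast
  have "continuous_on X g" using simplexwise_affine_imp_continuous_on[OF K(1) g(1)] K(2) by simp
  moreover have "pl_map X (Y \<times> UNIV) ?h" unfolding pl_map_def using fXY K h by blast
  moreover have "\<exists>k. homeomorphism X (?h ` X) ?h k"
  proof (rule homeomorphism_compact)
    show "compact X" using simplicial_complexD(1,3)[OF K(1)] K(2) by (auto intro: compact_Union)
    show "continuous_on X ?h" using simplexwise_affine_imp_continuous_on[OF K(1) h] K(2) by simp
    show "inj_on ?h X"
    proof (rule inj_onI, rule ccontr)
      fix x y assume xy: "x \<in> X" "y \<in> X" "?h x = ?h y" "x \<noteq> y"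
      then have D: "(x, y) \<in> double_points X f" "(y, x) \<in> double_points X f"
        by (auto simp: double_points_iff)
      have "\<phi> (x, y) = 1 \<or> \<phi> (y, x) = 1" using equivariant_signD[OF \<phi>(1) D(1)] by auto
      then show False using g(2) D xy(3) by fastforce
    qed
  qed simp
  ultimately show ?thesis unfolding pl_1_prem_def pl_embedding_def by blast
qed

text \<open>
  If no sign is acyclic, one bad triple for each of the finitely many signs makes a
  Penrose staircase.
\<close>

lemma no_staircase_imp_acyclic_sign:
  fixes X :: "'a::euclidean_space set" and f :: "'a \<Rightarrow> 'b::euclidean_space"
  assumes "pl_map X Y f" "non_degenerate X Y f" "\<not> (\<exists>F. penrose_staircase X f F)"
  shows "\<exists>\<phi>. equivariant_sign X f \<phi> \<and> acyclic_sign X f \<phi>"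
proof (rule ccontr)
  assume no: "\<not> ?thesis"
  obtain K where K: "simplicial_complex K" "\<Union>K = X" and f: "\<And>S. S \<in> K \<Longrightarrow> affine_map_on S f"
    and fXY: "f \<in> X \<rightarrow> Y"
    using assms(1) unfolding pl_map_def by blast
  have inj: "inj_on f S" if S: "S \<in> K" for S
    using non_degenerate_inj_on[OF assms(2) fXY _ simplicial_complexD(2)[OF K(1) S] f[OF S]] K(2) S
    by blast
  let ?D = "double_points X f"
  let ?R = "(\<lambda>\<phi>. restrict \<phi> ?D) ` {\<phi>. equivariant_sign X f \<phi>}"
  define bad where "bad \<psi> t \<longleftrightarrow> t \<in> triple_points X f \<and>
    (case t of (x, y, z) \<Rightarrow> \<psi> (x, y) = \<psi> (y, z) \<and> \<psi> (y, z) = \<psi> (z, x))" for \<psi> :: "'a \<times> 'a \<Rightarrow> real" and t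
  have restr: "bad (restrict \<phi> ?D) t \<longleftrightarrow> bad \<phi> t" for \<phi> t
    unfolding bad_def by (cases t) (auto simp: triple_points_iff)
  have "\<exists>t. bad \<phi> t" if "equivariant_sign X f \<phi>" for \<phi>
    using no that unfolding acyclic_sign_def bad_def by auto
  then have "\<forall>\<psi>\<in>?R. \<exists>t. bad \<psi> t" using restr by blast
  then obtain t where t: "\<forall>\<psi>\<in>?R. bad \<psi> (t \<psi>)" by metis
  have "penrose_staircase X f (t ` ?R)"
    unfolding penrose_staircase_def
  proof (intro conjI allI impI)
    show "finite (t ` ?R)" using finite_equivariant_signs[OF K f inj] by simp
    show "t ` ?R \<subseteq> triple_points X f" using t unfolding bad_def by blast
    fix \<phi> assume "equivariant_sign X f \<phi>"
    then have R: "restrict \<phi> ?D \<in> ?R" by blast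
    then have "bad \<phi> (t (restrict \<phi> ?D))" using t restr by blast
    then show "\<exists>(x, y, z)\<in>t ` ?R. \<phi> (x, y) = \<phi> (y, z) \<and> \<phi> (y, z) = \<phi> (z, x)"
      unfolding bad_def using imageI[OF R] by (intro bexI[of _ "t (restrict \<phi> ?D)"]) (rule conjunct2)
  qed
  then show False using assms(3) by blast
qed

lemma acyclic_sign_imp_no_staircase:
  assumes "equivariant_sign X f \<phi>" "acyclic_sign X f \<phi>"
  shows "\<not> penrose_staircase X f F"
proof
  assume "penrose_staircase X f F"
  then obtain x y z where "(x, y, z) \<in> triple_points X f" "\<phi> (x, y) = \<phi> (y, z)" "\<phi> (y, z) = \<phi> (z, x)"
    using assms(1) unfolding penrose_staircase_def by blast
  then show False using assms(2) unfolding acyclic_sign_def by metis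
qed

text \<open>
  A 3-cycle of signs equal to 1 would be a cycle in a linear order; if the signs are -1, the
  cycle runs backwards.
\<close>

lemma fibre_orders_imp_acyclic_sign:
  assumes "f \<in> X \<rightarrow> Y" and \<phi>: "equivariant_sign X f \<phi>"
    and ord: "\<forall>y\<in>Y. \<exists>r. linear_order_on (fibre X f y) r \<and>
              (\<forall>x\<in>fibre X f y. \<forall>x'\<in>fibre X f y. x \<noteq> x' \<longrightarrow> ((x, x') \<in> r \<longleftrightarrow> \<phi> (x, x') = 1))"
  shows "acyclic_sign X f \<phi>"
  unfolding acyclic_sign_def
proof (intro allI impI notI)
  fix x y z assume t: "(x, y, z) \<in> triple_points X f" and eq: "\<phi> (x, y) = \<phi> (y, z) \<and> \<phi> (y, z) = \<phi> (z, x)"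
  have D: "(x, y) \<in> double_points X f" "(y, z) \<in> double_points X f" "(z, x) \<in> double_points X f"
    using t by (auto simp: triple_points_iff)
  then have "f x \<in> Y" and F: "x \<in> fibre X f (f x)" "y \<in> fibre X f (f x)" "z \<in> fibre X f (f x)"
    and ne: "x \<noteq> y" "y \<noteq> z" "z \<noteq> x"
    using assms(1) by (auto simp: double_points_iff fibre_def)
  then obtain r where r: "linear_order_on (fibre X f (f x)) r"
    and iff: "\<And>a b. a \<in> fibre X f (f x) \<Longrightarrow> b \<in> fibre X f (f x) \<Longrightarrow> a \<noteq> b \<Longrightarrow> (a, b) \<in> r \<longleftrightarrow> \<phi> (a, b) = 1"
    using ord by blast
  have tr: "trans r" and anti: "antisym r" using r unfolding order_on_defs by auto
  have cyc: False if "(a, b) \<in> r" "(b, c) \<in> r" "(c, a) \<in> r" "a \<noteq> b" for a b c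
    using that transD[OF tr] antisymD[OF anti] by metis
  show False
  proof (cases "\<phi> (x, y) = 1")
    case True
    then show False using cyc[of x y z] iff F ne eq by auto
  next
    case False
    then have "\<phi> (y, x) = 1" "\<phi> (z, y) = 1" "\<phi> (x, z) = 1"
      using equivariant_signD[OF \<phi> D(1)] equivariant_signD[OF \<phi> D(2)] equivariant_signD[OF \<phi> D(3)] eq by auto
    then show False using cyc[of x z y] iff F ne by auto
  qed
qed

text \<open>
  The sign compares the two coordinates of \<open>\<Phi>\<close>. On a triple all three comparisons are made
  between the same three real numbers, the coordinates of \<open>\<Psi>\<close>, and real numbers cannot be
  ordered cyclically.
\<close>

lemma isovariant_pair_imp_acyclic_sign:
  fixes f :: "'a::topological_space \<Rightarrow> 'b"
  assumes \<Phi>: "S2_map (double_points X f) (deleted_square (UNIV :: real set)) \<Phi>"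
    and \<Psi>: "\<forall>j. inj_on j {1, 2} \<and> j ` {1, 2} \<subseteq> {1, 2, 3} \<longrightarrow>
              (\<forall>t\<in>triple_points X f. \<Phi> (proj32 j t) = proj32 j (\<Psi> t))"
  shows "\<exists>\<phi>. equivariant_sign X f \<phi> \<and> acyclic_sign X f \<phi>"
proof -
  let ?\<phi> = "\<lambda>p. sgn (snd (\<Phi> p) - fst (\<Phi> p))"
  have ran: "fst (\<Phi> p) \<noteq> snd (\<Phi> p)" if "p \<in> double_points X f" for p
    using \<Phi> that unfolding S2_map_def deleted_square_def by (force simp: Pi_iff)
  have "equivariant_sign X f ?\<phi>"
  proof (rule equivariant_sign_sgn)
    show "continuous_on (double_points X f) (\<lambda>p. snd (\<Phi> p) - fst (\<Phi> p))"
      using \<Phi> unfolding S2_map_def by (intro continuous_intros) auto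
    fix p assume p: "p \<in> double_points X f"
    show "snd (\<Phi> p) - fst (\<Phi> p) \<noteq> 0" using ran[OF p] by simp
    show "snd (\<Phi> (prod.swap p)) - fst (\<Phi> (prod.swap p)) = - (snd (\<Phi> p) - fst (\<Phi> p))"
      using \<Phi> p unfolding S2_map_def by simp
  qed
  moreover have "acyclic_sign X f ?\<phi>"
    unfolding acyclic_sign_def
  proof (intro allI impI notI)
    fix x y z assume t: "(x, y, z) \<in> triple_points X f"
      and eq: "?\<phi> (x, y) = ?\<phi> (y, z) \<and> ?\<phi> (y, z) = ?\<phi> (z, x)"
    obtain a b c where abc: "\<Psi> (x, y, z) = (a, b, c)" by (cases "\<Psi> (x, y, z)")
    have j: "\<Phi> (proj32 j (x, y, z)) = proj32 j (a, b, c)"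
      if "inj_on j {1, 2}" "j ` {1, 2} \<subseteq> {1, 2, 3}" for j
      using \<Psi> t that abc by metis
    \<comment> \<open>The injections picking the coordinates (1, 2), (2, 3) and (3, 1).\<close>
    have "\<Phi> (x, y) = (a, b)" using j[of "\<lambda>i. i"] by (simp add: proj32_def)
    moreover have "\<Phi> (y, z) = (b, c)" using j[of Suc] by (simp add: proj32_def)
    moreover have "\<Phi> (z, x) = (c, a)"
      using j[of "\<lambda>i. if i = 1 then 3 else 1"] by (simp add: proj32_def inj_on_def)
    moreover have "a \<noteq> b" using ran[of "(x, y)"] t calculation by (simp add: triple_points_iff)
    ultimately show False using eq by (auto simp: sgn_real_def split: if_splits)
  qed
  ultimately show ?thesis by blast
qed

theorem theorem5:
  fixes X :: "'a::euclidean_space set" and Y :: "'b::euclidean_space set" and f :: "'a \<Rightarrow> 'b"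
  assumes "compact_polyhedron X" and "compact_polyhedron Y"
    and "pl_map X Y f" and "non_degenerate X Y f"
  defines "cond1 \<equiv> pl_1_prem X Y f"
    and "cond2 \<equiv> (\<exists>\<phi>. equivariant_sign X f \<phi> \<and>
           (\<forall>y\<in>Y. \<exists>r. linear_order_on (fibre X f y) r \<and>
              (\<forall>x\<in>fibre X f y. \<forall>x'\<in>fibre X f y. x \<noteq> x' \<longrightarrow>
                 ((x, x') \<in> r \<longleftrightarrow> \<phi> (x, x') = 1))))"
    and "cond3 \<equiv> (\<exists>\<phi>. equivariant_sign X f \<phi> \<and>
           (\<forall>(x, y, z)\<in>triple_points X f.
              map_prod \<phi> (map_prod \<phi> \<phi>) ((x, y), (y, z), (z, x))
                \<in> sphere0 \<times> sphere0 \<times> sphere0 - thin_diagonal sphere0))"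
    and "cond4 \<equiv> \<not> (\<exists>F. penrose_staircase X f F)"
    and "cond5 \<equiv> (\<exists>\<Phi> \<Psi>.
           S2_map (double_points X f) (deleted_square (UNIV :: real set)) \<Phi> \<and>
           S3_map (triple_points X f) (deleted_cube (UNIV :: real set)) \<Psi> \<and>
           (\<forall>j. inj_on j {1, 2} \<and> j ` {1, 2} \<subseteq> {1, 2, 3} \<longrightarrow>
              (\<forall>t\<in>triple_points X f. \<Phi> (proj32 j t) = proj32 j (\<Psi> t))))"
  shows "(cond1 \<longleftrightarrow> cond2) \<and> (cond2 \<longleftrightarrow> cond3) \<and> (cond3 \<longleftrightarrow> cond4) \<and> (cond4 \<longleftrightarrow> cond5)"
proof -
  have fXY: "f \<in> X \<rightarrow> Y" using assms(3) unfolding pl_map_def by blast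
  have acyc: "cond3 \<longleftrightarrow> (\<exists>\<phi>. equivariant_sign X f \<phi> \<and> acyclic_sign X f \<phi>)"
    unfolding cond3_def by (rule iff_exI, rule conj_cong[OF refl], erule acyclic_sign_iff[symmetric])
  have "cond1 \<longrightarrow> cond2 \<and> cond5"
  proof
    assume cond1
    then obtain g :: "'a \<Rightarrow> real"
      where g: "continuous_on X g" "\<And>x y. (x, y) \<in> double_points X f \<Longrightarrow> g x \<noteq> g y"
      unfolding cond1_def using pl_1_prem_imp_height by blast
    have cond2
      unfolding cond2_def
    proof (intro exI conjI ballI impI)
      show "equivariant_sign X f (\<lambda>(x, y). sgn (g y - g x))" using g by (rule height_imp_equivariant_sign)
      fix y
      show "linear_order_on (fibre X f y) {(x, x'). x \<in> fibre X f y \<and> x' \<in> fibre X f y \<and> g x \<le> g x'}"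
        using g(2) by (rule height_imp_fibre_order)
      fix x x' assume x: "x \<in> fibre X f y" "x' \<in> fibre X f y" "x \<noteq> x'"
      then have "g x \<noteq> g x'" by (intro g(2)) (auto simp: double_points_iff fibre_def)
      then show "(x, x') \<in> {(x, x'). x \<in> fibre X f y \<and> x' \<in> fibre X f y \<and> g x \<le> g x'} \<longleftrightarrow>
          (case (x, x') of (x, y) \<Rightarrow> sgn (g y - g x)) = 1"
        using x by (auto simp: sgn_1_pos)
    qed
    moreover have cond5
      unfolding cond5_def using height_imp_equivariant_maps[OF g] by blast
    ultimately show "cond2 \<and> cond5" by blast
  qed
  moreover have "cond2 \<longrightarrow> cond3"
    unfolding acyc cond2_def using fibre_orders_imp_acyclic_sign[OF fXY] by blast
  moreover have "cond3 \<longrightarrow> cond1"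
    unfolding acyc cond1_def using acyclic_sign_imp_pl_1_prem[OF assms(3,4)] by blast
  moreover have "cond3 \<longleftrightarrow> cond4"
    unfolding acyc cond4_def
    using no_staircase_imp_acyclic_sign[OF assms(3,4)] acyclic_sign_imp_no_staircase by blast
  moreover have "cond5 \<longrightarrow> cond3"
    unfolding acyc cond5_def using isovariant_pair_imp_acyclic_sign[of X f] by blast
  ultimately show ?thesis by blast
qed

end
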